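(* Let $(X,d)$ be a nonempty metric space and let $U$ be a subset of $F_{USCG}(X)$. Then $U$ is totally bounded in $(F_{USCG}(X), H_{\rm end})$ if and only if $U(\alpha)$ is totally bounded in $(X,d)$ for each $\alpha\in(0,1]$.
   Context: A fuzzy set in $X$ is a function $u:X\to[0,1]$. For $\alpha\in(0,1]$, $[u]_\alpha=\{x\in X: u(x)\ge\alpha\}$, and $[u]_0=\overline{\{x\in X: u(x)>0\}}$ (closure in $X$). $C(X)$ and $K(X)$ denote the sets of all nonempty closed, respectively nonempty compact, subsets of $X$. $F_{USC}(X)$ is the set of fuzzy sets $u$ in $X$ with $[u]_\alpha\in C(X)\cup\{\emptyset\}$ for all $\alpha\in[0,1]$ (the upper semicontinuous fuzzy sets), and $F_{USCG}(X)=\{u\in F_{USC}(X): [u]_\alpha\in K(X)\cup\{\emptyset\}\text{ for all }\alpha\in(0,1]\}$. $X\times[0,1]$ carries the metric $\overline d((x,\alpha),(y,\beta))=d(x,y)+|\alpha-\beta|$. The endograph of $u$ is ${\rm end}\,u=\{(x,t)\in X\times[0,1]: u(x)\ge t\}$; for $u\in F_{USC}(X)$ it is a nonempty closed set. For nonempty closed $A,B\subseteq X\times[0,1]$, $H(A,B)=\max\{\sup_{a\in A}\inf_{b\in B}\overline d(a,b),\ \sup_{b\in B}\inf_{a\in A}\overline d(a,b)\}$. The endograph metric on $F_{USC}(X)$ and its subsets is $H_{\rm end}(u,v)=H({\rm end}\,u,{\rm end}\,v)$. For a set $U$ of fuzzy sets, $U(\alpha)=\bigcup_{u\in U}[u]_\alpha$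 (an empty union is $\emptyset$). A subset $A$ of a metric space is totally bounded if for each $\varepsilon>0$ there is a finite $S\subseteq A$ such that every point of $A$ is at distance less than $\varepsilon$ from $S$. *)

theory Defs
  imports "HOL-Analysis.Analysis"
begin

typedef 'a fuzzy_set = "{u :: 'a \<Rightarrow> real. \<forall>x. 0 \<le> u x \<and> u x \<le> 1}"
  morphisms membership Fuzzy_set
  by (rule exI[of _ "\<lambda>_. 0"]) simp

definition cut :: "'a::metric_space fuzzy_set \<Rightarrow> real \<Rightarrow> 'a set" where
  "cut u \<alpha> = (if \<alpha> = 0 then closure {x. membership u x > 0} else {x. membership u x \<ge> \<alpha>})"

(* Empty cuts are admitted in both classes: the empty set is closed and compact. *)

definition F_USC :: "'a::metric_space fuzzy_set set" where
  "F_USC = {u. \<forall>\<alpha>\<in>{0..1}. closed (cut u \<alpha>)}"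

definition F_USCG :: "'a::metric_space fuzzy_set set" where
  "F_USCG = {u \<in> F_USC. \<forall>\<alpha>\<in>{0<..1}. compact (cut u \<alpha>)}"

definition endograph :: "'a fuzzy_set \<Rightarrow> ('a \<times> real) set" where
  "endograph u = {(x, t). t \<in> {0..1} \<and> membership u x \<ge> t}"

(* The sum metric; the type-class metric on the product type is the Euclidean combination. *)
definition sum_dist :: "'a::metric_space \<times> real \<Rightarrow> 'a \<times> real \<Rightarrow> real" where
  "sum_dist p q = dist (fst p) (fst q) + \<bar>snd p - snd q\<bar>"

(* The real-valued suprema are meaningful for endographs: every endograph contains
   the whole of X x {0}, so all the infima below are at most 1. *)
definition hausdorff_dist :: "('a::metric_space \<times> real) set \<Rightarrow> ('a \<times> real) set \<Rightarrow> real" where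
  "hausdorff_dist A B =
     max (SUP a\<in>A. INF b\<in>B. sum_dist a b) (SUP b\<in>B. INF a\<in>A. sum_dist a b)"

definition H_end :: "'a::metric_space fuzzy_set \<Rightarrow> 'a fuzzy_set \<Rightarrow> real" where
  "H_end u v = hausdorff_dist (endograph u) (endograph v)"

definition cut_union :: "'a::metric_space fuzzy_set set \<Rightarrow> real \<Rightarrow> 'a set" where
  "cut_union U \<alpha> = (\<Union>u\<in>U. cut u \<alpha>)"

lemma membership_bounds: "0 \<le> membership u x" "membership u x \<le> 1"
  using membership[of u] by auto

lemma sum_dist_nonneg: "0 \<le> sum_dist p q"
  by (simp add: sum_dist_def)

lemma sum_dist_commute: "sum_dist p q = sum_dist q p"
  by (simp add: sum_dist_def dist_commute abs_minus_commute)

lemma sum_dist_triangle: "sum_dist p r \<le> sum_dist p q + sum_dist q r"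
  using dist_triangle[of "fst p" "fst r" "fst q"] by (simp add: sum_dist_def)

lemma sum_dist_refl: "sum_dist p p = 0"
  by (simp add: sum_dist_def)

lemma bdd_below_sum_dist: "bdd_below (sum_dist p ` A)"
  by (rule bdd_belowI2[where m = 0]) (rule sum_dist_nonneg)

lemma endograph_base: "(x, 0) \<in> endograph u"
  by (simp add: endograph_def membership_bounds)

lemma endograph_nonempty: "endograph u \<noteq> {}"
  using endograph_base[of undefined u] by (metis empty_iff)

lemma INF_endograph_nonneg: "0 \<le> (INF q\<in>endograph v. sum_dist p q)"
  by (rule cINF_greatest) (auto simp: endograph_nonempty sum_dist_nonneg)

lemma INF_endograph_le_1:
  assumes "p \<in> endograph u"
  shows "(INF q\<in>endograph v. sum_dist p q) \<le> 1"
proof -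
  have "(INF q\<in>endograph v. sum_dist p q) \<le> sum_dist p (fst p, 0)"
    by (rule cINF_lower[OF bdd_below_sum_dist endograph_base])
  also have "\<dots> \<le> 1"
    using assms by (auto simp: sum_dist_def endograph_def)
  finally show ?thesis .
qed

lemma bdd_above_INF_endograph:
  "bdd_above ((\<lambda>p. INF q\<in>endograph v. sum_dist p q) ` endograph u)"
  by (rule bdd_aboveI2[where M = 1]) (rule INF_endograph_le_1)

lemma H_end_alt:
  "H_end u v = max (SUP p\<in>endograph u. INF q\<in>endograph v. sum_dist p q)
                   (SUP p\<in>endograph v. INF q\<in>endograph u. sum_dist p q)"
  by (simp add: H_end_def hausdorff_dist_def sum_dist_commute)

lemma H_end_commute: "H_end u v = H_end v u"
  by (simp add: H_end_alt max.commute)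

lemma INF_le_H_end:
  assumes "p \<in> endograph u"
  shows "(INF q\<in>endograph v. sum_dist p q) \<le> H_end u v"
  using cSUP_upper[OF assms bdd_above_INF_endograph[of v u]] by (simp add: H_end_alt)

lemma H_end_nonneg: "0 \<le> H_end u v"
  using INF_le_H_end[OF endograph_base] INF_endograph_nonneg by (rule order_trans[rotated])

lemma H_end_lessD:
  assumes "H_end u v < r" "p \<in> endograph u"
  obtains q where "q \<in> endograph v" "sum_dist p q < r"
proof -
  have "(INF q\<in>endograph v. sum_dist p q) < r"
    using INF_le_H_end[OF assms(2)] assms(1) by (rule le_less_trans)
  then show ?thesis
    using that by (auto simp: cINF_less_iff[OF endograph_nonempty bdd_below_sum_dist])
qed

lemma H_end_leI:
  assumes "\<And>p. p \<in> endograph u \<Longrightarrow> \<exists>q\<in>endograph v. sum_dist p q \<le> r"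
    and "\<And>p. p \<in> endograph v \<Longrightarrow> \<exists>q\<in>endograph u. sum_dist p q \<le> r"
  shows "H_end u v \<le> r"
proof -
  have *: "(SUP p\<in>endograph u. INF q\<in>endograph v. sum_dist p q) \<le> r"
    if "\<And>p. p \<in> endograph u \<Longrightarrow> \<exists>q\<in>endograph v. sum_dist p q \<le> r" for u v :: "'a fuzzy_set"
    by (rule cSUP_least[OF endograph_nonempty])
       (use that cINF_lower2[OF bdd_below_sum_dist] in blast)
  show ?thesis
    unfolding H_end_alt using *[OF assms(1)] *[OF assms(2)] by simp
qed

lemma H_end_triangle: "H_end u w \<le> H_end u v + H_end v w"
proof (rule field_le_epsilon)
  fix e :: real assume "0 < e"
  have *: "\<exists>q\<in>endograph w. sum_dist p q \<le> H_end u v + H_end v w + e"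
    if p: "p \<in> endograph u" for p and u v w :: "'a fuzzy_set"
  proof -
    obtain q where q: "q \<in> endograph v" "sum_dist p q < H_end u v + e/2"
      using H_end_lessD[OF _ p, of v "H_end u v + e/2"] \<open>0 < e\<close> by auto
    obtain r where r: "r \<in> endograph w" "sum_dist q r < H_end v w + e/2"
      using H_end_lessD[OF _ q(1), of w "H_end v w + e/2"] \<open>0 < e\<close> by auto
    show ?thesis
      using sum_dist_triangle[of p r q] q r by (intro bexI[of _ r]) auto
  qed
  show "H_end u w \<le> H_end u v + H_end v w + e"
  proof (rule H_end_leI)
    show "\<exists>q\<in>endograph w. sum_dist p q \<le> H_end u v + H_end v w + e" if "p \<in> endograph u" for p
      using that by (rule *)
    show "\<exists>q\<in>endograph u. sum_dist p q \<le> H_end u v + H_end v w + e" if "p \<in> endograph w" for p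
      using *[OF that, of u v]
      unfolding H_end_commute[of w v] H_end_commute[of v u] add.commute[of "H_end v w"] .
  qed
qed

lemma H_end_eq_0_imp_le:
  assumes "v \<in> F_USC" "H_end u v = 0"
  shows "membership u x \<le> membership v x"
proof (rule ccontr)
  assume "\<not> ?thesis"
  then have "membership v x < membership u x"
    by simp
  then obtain b where b: "membership v x < b" "b < membership u x"
    using dense by blast
  then have b01: "0 < b" "b \<le> 1"
    using membership_bounds[of v x] membership_bounds[of u x] by auto
  then have "closed (cut v b)"
    using assms(1) by (simp add: F_USC_def)
  moreover have "x \<notin> cut v b"
    using b b01 by (simp add: cut_def)
  ultimately have "open (- cut v b)" "x \<in> - cut v b"
    by auto
  then obtain r where r: "r > 0" "ball x r \<subseteq> - cut v b"
    by (rule openE)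
  let ?r = "min r (membership u x - b)"
  have "(x, membership u x) \<in> endograph u"
    by (simp add: endograph_def membership_bounds)
  moreover have "H_end u v < ?r"
    using assms(2) r(1) b(2) by simp
  ultimately obtain q where q: "q \<in> endograph v" "sum_dist (x, membership u x) q < ?r"
    using H_end_lessD by blast
  have "dist x (fst q) < r" "b < snd q"
    using q(2) zero_le_dist[of x "fst q"] abs_ge_zero[of "membership u x - snd q"]
      abs_ge_self[of "membership u x - snd q"]
    unfolding sum_dist_def by (simp_all del: abs_ge_zero zero_le_dist)
  then have "fst q \<notin> cut v b" "membership v (fst q) \<ge> b"
    using q(1) r(2) by (auto simp: endograph_def)
  then show False
    using b01 by (simp add: cut_def)
qed

lemma Metric_space_F_USC: "Metric_space F_USC H_end"
proof
  fix u v :: "'a fuzzy_set"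
  assume "u \<in> F_USC" "v \<in> F_USC"
  show "H_end u v = 0 \<longleftrightarrow> u = v"
  proof
    assume "H_end u v = 0"
    then have "membership u = membership v"
      using \<open>u \<in> F_USC\<close> \<open>v \<in> F_USC\<close>
        H_end_eq_0_imp_le[of v u] H_end_eq_0_imp_le[of u v] H_end_commute[of u v]
      by (intro ext antisym) auto
    then show "u = v"
      by (simp add: membership_inject)
  next
    assume "u = v"
    have "H_end v v \<le> 0"
      by (rule H_end_leI) (metis order_refl sum_dist_refl)+
    then have "H_end u v \<le> 0"
      using \<open>u = v\<close> by simp
    then show "H_end u v = 0"
      using H_end_nonneg by (rule antisym)
  qed
qed (rule H_end_nonneg H_end_commute H_end_triangle)+

lemma Metric_space_F_USCG: "Metric_space F_USCG H_end"
  by (rule Metric_space.subspace[OF Metric_space_F_USC]) (auto simp: F_USCG_def)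

end

theory Submission
  imports Defs
begin

text \<open>
  For \<open>0 < t \<le> 1\<close> the pair \<open>(x, t)\<close> lies in the endograph of \<open>u\<close> exactly when \<open>x\<close> lies in the
  \<open>t\<close>-cut, and a point of height at most \<open>\<delta>\<close> can always be matched, at cost at
  most \<open>\<delta>\<close>, by the point below it of height \<open>0\<close>, which belongs to every endograph. Hence, up to
  \<open>\<delta>\<close>, the endograph metric sees only the cuts at levels above \<open>\<delta>\<close>.

  If \<open>U\<close> is totally bounded, then for small \<open>\<delta>\<close> every \<open>u \<in> U\<close> is \<open>\<delta>\<close>-close to one of finitely
  many members \<open>w\<close>, so a point of the \<open>\<alpha>\<close>-cut of \<open>u\<close> is \<open>\<delta>\<close>-close to the \<open>(\<alpha> - \<delta>)\<close>-cut of \<open>w\<close>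
  (\<open>cut_near_lower_cut\<close>). These finitely many cuts are compact, so the union of all \<open>\<alpha>\<close>-cuts is
  approximated to any precision by totally bounded sets, and is therefore totally bounded.

  Conversely, if the union of the \<open>\<delta>\<close>-cuts has a finite \<open>\<delta>\<close>-net \<open>F\<close>, record for each \<open>u \<in> U\<close>
  which cells of the grid made of the balls around \<open>F\<close> and the levels \<open>\<delta>, 2\<delta>, 3\<delta>, \<dots>\<close> up to \<open>1\<close>
  its endograph meets (\<open>grid_trace\<close>). There are finitely many such records, and two members of
  \<open>U\<close> with the same record are at distance at most \<open>3\<delta>\<close> (\<open>H_end_le_if_same_grid_trace\<close>).

  Neither argument directly produces centres inside the set to be covered; the criterion
  \<open>mtotally_bounded_if_finite_colourings\<close> supplies them.
\<close>

section \<open>Criteria for total boundedness\<close>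

text \<open>
  Total boundedness demands centres in the set itself. A finite colouring with small colour
  classes provides them: take one representative of each colour that occurs.
\<close>

lemma (in Metric_space) mtotally_bounded_if_finite_colourings:
  fixes S :: "'a set"
  assumes "S \<subseteq> M"
    and colouring: "\<And>\<epsilon>. \<epsilon> > 0 \<Longrightarrow>
      \<exists>c :: 'a \<Rightarrow> 'b. finite (c ` S) \<and> (\<forall>x\<in>S. \<forall>y\<in>S. c x = c y \<longrightarrow> d x y < \<epsilon>)"
  shows "mtotally_bounded S"
  unfolding mtotally_bounded_def
proof (intro allI impI)
  fix \<epsilon> :: real assume "\<epsilon> > 0"
  then obtain c :: "'a \<Rightarrow> 'b" where c: "finite (c ` S)"
    "\<And>x y. x \<in> S \<Longrightarrow> y \<in> S \<Longrightarrow> c x = c y \<Longrightarrow> d x y < \<epsilon>"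
    using colouring by blast
  let ?rep = "\<lambda>x. inv_into S c (c x)"
  have rep: "?rep x \<in> S" "c (?rep x) = c x" if "x \<in> S" for x
    using that by (auto intro: inv_into_into f_inv_into_f)
  have "?rep ` S = inv_into S c ` c ` S"
    by (simp add: image_image)
  then have "finite (?rep ` S)"
    using c(1) by simp
  moreover have "?rep ` S \<subseteq> S"
    using rep(1) by blast
  moreover have "x \<in> mball (?rep x) \<epsilon>" if "x \<in> S" for x
    using that rep c(2) \<open>S \<subseteq> M\<close> by (auto simp: in_mball)
  then have "S \<subseteq> (\<Union>k\<in>?rep ` S. mball k \<epsilon>)"
    by blast
  ultimately show "\<exists>K. finite K \<and> K \<subseteq> S \<and> S \<subseteq> (\<Union>x\<in>K. mball x \<epsilon>)"
    by blast
qed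

text \<open>
  A finite net of \<open>T\<close> is, at twice the precision, a net of \<open>S\<close>, but its points need not lie in \<open>S\<close>.
  They serve as colours instead: each point of \<open>S\<close> gets the colour of a net point near it.
\<close>

lemma (in Metric_space) mtotally_bounded_if_approximable:
  assumes "S \<subseteq> M"
    and approx: "\<And>\<epsilon>. \<epsilon> > 0 \<Longrightarrow> \<exists>T. mtotally_bounded T \<and> S \<subseteq> (\<Union>t\<in>T. mball t \<epsilon>)"
  shows "mtotally_bounded S"
  using \<open>S \<subseteq> M\<close>
proof (rule mtotally_bounded_if_finite_colourings)
  fix \<epsilon> :: real assume "\<epsilon> > 0"
  then have "\<epsilon>/4 > 0" by simp
  obtain T where T: "mtotally_bounded T" "S \<subseteq> (\<Union>t\<in>T. mball t (\<epsilon>/4))"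
    using approx[OF \<open>\<epsilon>/4 > 0\<close>] by blast
  obtain K where K: "finite K" "T \<subseteq> (\<Union>k\<in>K. mball k (\<epsilon>/4))"
    using T(1)[unfolded mtotally_bounded_def, rule_format, OF \<open>\<epsilon>/4 > 0\<close>] by metis
  have "\<exists>k. k \<in> K \<and> k \<in> M \<and> d k x < \<epsilon>/2" if x: "x \<in> S" for x
  proof -
    obtain t where t: "t \<in> T" "x \<in> mball t (\<epsilon>/4)"
      using T(2) x by blast
    then obtain k where k: "k \<in> K" "t \<in> mball k (\<epsilon>/4)"
      using K(2) by blast
    then show ?thesis
      using t triangle[of k t x] by (auto simp: in_mball intro!: exI[of _ k])
  qed
  then obtain c where c: "\<And>x. x \<in> S \<Longrightarrow> c x \<in> K \<and> c x \<in> M \<and> d (c x) x < \<epsilon>/2"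
    by metis
  have "finite (c ` S)"
    using c by (intro finite_subset[OF _ K(1)]) blast
  moreover have "d x y < \<epsilon>" if "x \<in> S" "y \<in> S" "c x = c y" for x y
  proof -
    have "d x y \<le> d (c x) x + d (c x) y"
      using triangle[of x "c x" y] c[OF that(1)] that \<open>S \<subseteq> M\<close> by (auto simp: commute)
    then show ?thesis
      using c[OF that(1)] c[OF that(2)] that(3) by simp
  qed
  ultimately show "\<exists>c :: 'a \<Rightarrow> 'a. finite (c ` S) \<and> (\<forall>x\<in>S. \<forall>y\<in>S. c x = c y \<longrightarrow> d x y < \<epsilon>)"
    by blast
qed

section \<open>Cuts of fuzzy sets that are close in the endograph metric\<close>

lemma mem_cut_iff: "\<alpha> > 0 \<Longrightarrow> x \<in> cut u \<alpha> \<longleftrightarrow> \<alpha> \<le> membership u x"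
  by (simp add: cut_def)

text \<open>
  The sum metric bounds the horizontal and the vertical displacement separately. As \<open>\<delta> < \<alpha>\<close>, the
  point of the endograph of \<open>w\<close> near \<open>(x, \<alpha>)\<close> keeps a positive height, so it cannot be a mere
  point of the base.
\<close>

lemma cut_near_lower_cut:
  assumes "x \<in> cut u \<alpha>" "0 < \<alpha>" "\<alpha> \<le> 1" "H_end u w < \<delta>" "\<delta> < \<alpha>"
  obtains y where "y \<in> cut w (\<alpha> - \<delta>)" "dist y x < \<delta>"
proof -
  have "(x, \<alpha>) \<in> endograph u"
    using assms by (simp add: endograph_def mem_cut_iff)
  then obtain q where q: "q \<in> endograph w" "sum_dist (x, \<alpha>) q < \<delta>"
    using H_end_lessD[OF assms(4)] by blast
  obtain y s where y: "q = (y, s)"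
    by fastforce
  have *: "dist y x + \<bar>\<alpha> - s\<bar> < \<delta>"
    using q(2) by (simp add: y sum_dist_def dist_commute)
  then have "dist y x < \<delta>" "\<alpha> - \<delta> < s"
    using zero_le_dist[of y x] by linarith+
  then have "y \<in> cut w (\<alpha> - \<delta>)"
    using q(1) assms by (auto simp: y endograph_def mem_cut_iff)
  with \<open>dist y x < \<delta>\<close> show thesis
    by (rule that[rotated])
qed

lemma mtotally_bounded_cut_union:
  assumes U: "U \<subseteq> F_USCG" "Metric_space.mtotally_bounded F_USCG H_end U"
    and \<alpha>: "\<alpha> \<in> {0<..1}"
  shows "Met_TC.mtotally_bounded (cut_union U \<alpha>)"
proof (rule Met_TC.mtotally_bounded_if_approximable)
  interpret F: Metric_space F_USCG "H_end :: 'a fuzzy_set \<Rightarrow> 'a fuzzy_set \<Rightarrow> real"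
    by (rule Metric_space_F_USCG)
  fix \<epsilon> :: real assume "\<epsilon> > 0"
  \<comment> \<open>The bound \<open>\<alpha>/2\<close> keeps the level \<open>\<alpha> - \<delta>\<close> positive, where cuts are compact.\<close>
  define \<delta> where "\<delta> = min \<epsilon> (\<alpha>/2)"
  have \<delta>: "0 < \<delta>" "\<delta> \<le> \<epsilon>" "\<delta> < \<alpha>" "\<alpha> - \<delta> \<in> {0<..1}"
    using \<open>\<epsilon> > 0\<close> \<alpha> by (auto simp: \<delta>_def)
  obtain K where K: "finite K" "K \<subseteq> U" "U \<subseteq> (\<Union>w\<in>K. F.mball w \<delta>)"
    using U(2)[unfolded F.mtotally_bounded_def, rule_format, OF \<delta>(1)] by metis
  have "compact (cut w (\<alpha> - \<delta>))" if "w \<in> K" for w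
    using that K(2) U(1) \<delta>(4) unfolding F_USCG_def by blast
  then have "compact (\<Union>w\<in>K. cut w (\<alpha> - \<delta>))"
    using K(1) by (rule compact_UN[rotated])
  then have "Met_TC.mtotally_bounded (\<Union>w\<in>K. cut w (\<alpha> - \<delta>))"
    using Met_TC.compactin_imp_mtotally_bounded by simp
  moreover have "cut_union U \<alpha> \<subseteq> (\<Union>y\<in>(\<Union>w\<in>K. cut w (\<alpha> - \<delta>)). ball y \<epsilon>)"
  proof
    fix x assume "x \<in> cut_union U \<alpha>"
    then obtain u where u: "u \<in> U" "x \<in> cut u \<alpha>"
      by (auto simp: cut_union_def)
    then obtain w where w: "w \<in> K" "H_end u w < \<delta>"
      using K(3) by (auto simp: F.in_mball H_end_commute)
    obtain y where "y \<in> cut w (\<alpha> - \<delta>)" "dist y x < \<delta>"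
      using cut_near_lower_cut[OF u(2) _ _ w(2) \<delta>(3)] \<alpha> by auto
    then show "x \<in> (\<Union>y\<in>(\<Union>w\<in>K. cut w (\<alpha> - \<delta>)). ball y \<epsilon>)"
      using w(1) \<delta>(2) by force
  qed
  ultimately show "\<exists>T. Met_TC.mtotally_bounded T \<and> cut_union U \<alpha> \<subseteq> (\<Union>t\<in>T. Met_TC.mball t \<epsilon>)"
    by (intro exI[of _ "\<Union>w\<in>K. cut w (\<alpha> - \<delta>)"]) simp
qed simp

section \<open>Discretising endographs\<close>

text \<open>
  Level \<open>0\<close> is left out: every endograph contains the whole base, so it carries no information
  about \<open>u\<close>. Bounding \<open>k * \<delta>\<close> by \<open>1\<close>, the largest possible membership degree, leaves
  finitely many cells.
\<close>

definition grid_trace :: "'a::metric_space set \<Rightarrow> real \<Rightarrow> 'a fuzzy_set \<Rightarrow> ('a \<times> nat) set" where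
  "grid_trace F \<delta> u = {(f, k). f \<in> F \<and> 1 \<le> k \<and> real k * \<delta> \<le> 1 \<and>
     (\<exists>x. dist f x < \<delta> \<and> real k * \<delta> \<le> membership u x)}"

lemma finite_range_grid_trace:
  assumes "finite F" "\<delta> > 0"
  shows "finite (grid_trace F \<delta> ` U)"
proof (rule finite_subset)
  have "k \<le> nat \<lceil>1/\<delta>\<rceil>" if "real k * \<delta> \<le> 1" for k
  proof -
    have "real k \<le> 1/\<delta>"
      using that assms(2) by (simp add: field_simps)
    then show ?thesis
      by linarith
  qed
  then show "grid_trace F \<delta> ` U \<subseteq> Pow (F \<times> {..nat \<lceil>1/\<delta>\<rceil>})"
    by (auto simp: grid_trace_def)
  show "finite (Pow (F \<times> {..nat \<lceil>1/\<delta>\<rceil>}))"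
    using assms(1) by simp
qed

text \<open>
  A point of height \<open>t \<le> \<delta>\<close> is matched by its projection to the base. A higher point \<open>(x, t)\<close> is
  rounded down to a level \<open>k * \<delta>\<close>, losing at most \<open>\<delta>\<close>; the cell that it meets is also met by the
  endograph of \<open>v\<close>, and passing through the centre of that cell costs at most \<open>2 * \<delta>\<close> more.
\<close>

lemma endograph_near_if_grid_trace_subset:
  assumes \<delta>: "\<delta> > 0"
    and F: "cut u \<delta> \<subseteq> (\<Union>f\<in>F. ball f \<delta>)"
    and trace: "grid_trace F \<delta> u \<subseteq> grid_trace F \<delta> v"
    and p: "p \<in> endograph u"
  shows "\<exists>q\<in>endograph v. sum_dist p q \<le> 3 * \<delta>"
proof -
  obtain x t where xt: "p = (x, t)" "0 \<le> t" "t \<le> 1" "t \<le> membership u x"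
    using p by (auto simp: endograph_def)
  show ?thesis
  proof (cases "t \<le> \<delta>")
    case True
    then show ?thesis
      using xt \<delta> by (intro bexI[OF _ endograph_base[of x v]]) (simp add: sum_dist_def)
  next
    case False
    define k where "k = nat \<lfloor>t/\<delta>\<rfloor>"
    have "1 \<le> \<lfloor>t/\<delta>\<rfloor>"
      using False \<delta> by simp
    then have k: "1 \<le> k" "real k \<le> t/\<delta>" "t/\<delta> < real k + 1"
      unfolding k_def by linarith+
    then have kt: "real k * \<delta> \<le> t" "t < real k * \<delta> + \<delta>"
      using \<delta> by (simp_all add: field_simps)
    have "x \<in> cut u \<delta>"
      using False xt \<delta> by (simp add: mem_cut_iff)
    then obtain f where f: "f \<in> F" "dist f x < \<delta>"
      using F by auto
    then have "(f, k) \<in> grid_trace F \<delta> u"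
      using k(1) kt xt by (auto simp: grid_trace_def intro!: exI[of _ x])
    then have "(f, k) \<in> grid_trace F \<delta> v"
      using trace by blast
    then obtain y where y: "dist f y < \<delta>" "real k * \<delta> \<le> membership v y"
      by (auto simp: grid_trace_def)
    have "(y, real k * \<delta>) \<in> endograph v"
      using y kt xt \<delta> by (simp add: endograph_def)
    moreover have "sum_dist p (y, real k * \<delta>) \<le> 3 * \<delta>"
      using dist_triangle3[of x y f] f(2) y(1) kt by (simp add: xt sum_dist_def)
    ultimately show ?thesis
      by blast
  qed
qed

lemma H_end_le_if_same_grid_trace:
  assumes "\<delta> > 0"
    and "cut u \<delta> \<subseteq> (\<Union>f\<in>F. ball f \<delta>)" "cut v \<delta> \<subseteq> (\<Union>f\<in>F. ball f \<delta>)"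
    and "grid_trace F \<delta> u = grid_trace F \<delta> v"
  shows "H_end u v \<le> 3 * \<delta>"
  by (rule H_end_leI; rule endograph_near_if_grid_trace_subset[where F = F]) (use assms in auto)

lemma mtotally_bounded_if_cut_unions:
  assumes U: "U \<subseteq> F_USCG"
    and cuts: "\<And>\<alpha>. \<alpha> \<in> {0<..1} \<Longrightarrow> Met_TC.mtotally_bounded (cut_union U \<alpha>)"
  shows "Metric_space.mtotally_bounded F_USCG H_end U"
  using Metric_space_F_USCG U
proof (rule Metric_space.mtotally_bounded_if_finite_colourings)
  fix \<epsilon> :: real assume "\<epsilon> > 0"
  \<comment> \<open>\<open>\<epsilon>/4\<close> rather than \<open>\<epsilon>/3\<close> turns the bound \<open>3 * \<delta>\<close> into a strict one.\<close>
  define \<delta> where "\<delta> = min 1 (\<epsilon>/4)"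
  have \<delta>: "\<delta> > 0" "\<delta> \<in> {0<..1}" "3 * \<delta> < \<epsilon>"
    using \<open>\<epsilon> > 0\<close> by (auto simp: \<delta>_def)
  obtain F where F: "finite F" "cut_union U \<delta> \<subseteq> (\<Union>f\<in>F. ball f \<delta>)"
    using cuts[OF \<delta>(2), unfolded Met_TC.mtotally_bounded_def mball_eq_ball, rule_format, OF \<delta>(1)]
    by metis
  have "cut u \<delta> \<subseteq> (\<Union>f\<in>F. ball f \<delta>)" if "u \<in> U" for u
    using that F(2) unfolding cut_union_def by blast
  then have "H_end u v < \<epsilon>" if "u \<in> U" "v \<in> U" "grid_trace F \<delta> u = grid_trace F \<delta> v" for u v
    using H_end_le_if_same_grid_trace[OF \<delta>(1) _ _ that(3)] that \<delta>(3) by fastforce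
  then show "\<exists>c :: 'a fuzzy_set \<Rightarrow> ('a \<times> nat) set. finite (c ` U) \<and>
      (\<forall>u\<in>U. \<forall>v\<in>U. c u = c v \<longrightarrow> H_end u v < \<epsilon>)"
    using finite_range_grid_trace[OF F(1) \<delta>(1)] by (intro exI[of _ "grid_trace F \<delta>"]) blast
qed

section \<open>Total boundedness in the endograph metric\<close>

theorem theorem5p14:
  fixes U :: "'a::metric_space fuzzy_set set"
  assumes "U \<subseteq> F_USCG"
  shows "Metric_space.mtotally_bounded F_USCG H_end U \<longleftrightarrow>
    (\<forall>\<alpha>\<in>{0<..1}. Met_TC.mtotally_bounded (cut_union U \<alpha>))"
  using mtotally_bounded_cut_union[OF assms] mtotally_bounded_if_cut_unions[OF assms] by blast

end
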